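(* No set of exactly $6$ vertices of the generalized Petersen graph $P(12,3)$ is a zero forcing set of $P(12,3)$. Hence $Z(P(12,3)) = 7$.
   Context: Let $G=(V,E)$ be a finite simple graph. Color a subset $S\subseteq V$ black and the remaining vertices white. Color change rule: a black vertex with exactly one white neighbor forces that neighbor to become black. Iterating this rule starting from $S$ until no further force is possible gives the closure $\mathrm{cl}(S)$. The set $S$ is a zero forcing set of $G$ if $\mathrm{cl}(S)=V$, and the zero forcing number $Z(G)$ is the minimum cardinality of a zero forcing set. For $n\ge 3$ and $1\le k<n/2$, the generalized Petersen graph $P(n,k)$ has the $2n$ vertices $\{u_0,\dots,u_{n-1}\}\cup\{v_0,\dots,v_{n-1}\}$ and edges $u_i\sim u_{i+1}$, $u_i\sim v_i$, and $v_i\sim v_{i+k}$ for all $i$, with indices taken modulo $n$. *)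

theory Defs
  imports "Graph_Theory.Graph_Theory"
begin

text \<open>
  A finite simple graph is a \<^locale>\<open>pair_graph\<close>: a finite, loop-free, symmetric digraph whose
  arcs are pairs of vertices.
\<close>

section \<open>Zero forcing\<close>

text \<open>One application of the colour change rule; \<^term>\<open>B\<close> is the set of black vertices.\<close>

inductive force_step :: "'a pair_pre_digraph \<Rightarrow> 'a set \<Rightarrow> 'a set \<Rightarrow> bool" for G where
  "u \<in> B \<Longrightarrow> {w. (u, w) \<in> parcs G \<and> w \<notin> B} = {v} \<Longrightarrow> force_step G B (insert v B)"

definition stalled :: "'a pair_pre_digraph \<Rightarrow> 'a set \<Rightarrow> bool" where
  "stalled G B \<longleftrightarrow> (\<nexists>B'. force_step G B B')"

text \<open>
  The order of the forces does not matter, so that the description below determines the closure;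
  see \<open>ex1_zf_closure\<close>.
\<close>

definition zf_closure :: "'a pair_pre_digraph \<Rightarrow> 'a set \<Rightarrow> 'a set" where
  "zf_closure G S = (THE C. (force_step G)\<^sup>*\<^sup>* S C \<and> stalled G C)"

definition zero_forcing_set :: "'a pair_pre_digraph \<Rightarrow> 'a set \<Rightarrow> bool" where
  "zero_forcing_set G S \<longleftrightarrow> S \<subseteq> pverts G \<and> zf_closure G S = pverts G"

definition zero_forcing_number :: "'a pair_pre_digraph \<Rightarrow> nat" where
  "zero_forcing_number G = (LEAST m. \<exists>S. zero_forcing_set G S \<and> card S = m)"

lemma force_steps_subset_stalled:
  assumes "(force_step G)\<^sup>*\<^sup>* S C" "S \<subseteq> D" "stalled G D"
  shows "C \<subseteq> D"
  using assms(1)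
proof (induction rule: rtranclp_induct)
  case base
  show ?case by (fact assms(2))
next
  case (step B B')
  from step.hyps(2) show ?case
  proof cases
    case (1 u v)
    have "v \<in> D"
    proof (rule ccontr)
      assume "v \<notin> D"
      with 1 step.IH have "{w. (u, w) \<in> parcs G \<and> w \<notin> D} = {v}"
        by blast
      moreover have "u \<in> D" using 1 step.IH by blast
      ultimately show False
        using assms(3) force_step.intros unfolding stalled_def by metis
    qed
    with 1 step.IH show ?thesis by blast
  qed
qed

lemma (in pair_graph) ex_force_steps_stalled:
  "\<exists>C. (force_step G)\<^sup>*\<^sup>* B C \<and> stalled G C"
proof (induction "card (pverts G - B)" arbitrary: B rule: less_induct)
  case less
  show ?case
  proof (cases "stalled G B")
    case True
    then show ?thesis by blast
  next
    case False
    then obtain B' where B': "force_step G B B'"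
      unfolding stalled_def by blast
    then obtain u v where "(u, v) \<in> parcs G" "v \<notin> B" "B' = insert v B"
      by cases blast
    then have "pverts G - B' \<subset> pverts G - B"
      using in_arcsD2 by blast
    then have "card (pverts G - B') < card (pverts G - B)"
      by (intro psubset_card_mono) (use pair_finite_verts in auto)
    then obtain C where "(force_step G)\<^sup>*\<^sup>* B' C" "stalled G C"
      using less by blast
    with B' show ?thesis
      by (meson converse_rtranclp_into_rtranclp)
  qed
qed

lemma force_steps_increasing: "(force_step G)\<^sup>*\<^sup>* S C \<Longrightarrow> S \<subseteq> C"
  by (induction rule: rtranclp_induct) (auto elim!: force_step.cases)

lemma (in pair_graph) ex1_zf_closure:
  "\<exists>!C. (force_step G)\<^sup>*\<^sup>* S C \<and> stalled G C"
  using ex_force_steps_stalled[of S]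
  by (meson force_steps_increasing force_steps_subset_stalled subset_antisym)

section \<open>Generalized Petersen graphs\<close>

datatype gp_vertex = U nat | V nat

definition gp_edges :: "nat \<Rightarrow> nat \<Rightarrow> gp_vertex rel" where
  "gp_edges n k =
     {(U i, U ((i + 1) mod n)) | i. i < n} \<union>
     {(U i, V i) | i. i < n} \<union>
     {(V i, V ((i + k) mod n)) | i. i < n}"

definition generalized_petersen :: "nat \<Rightarrow> nat \<Rightarrow> gp_vertex pair_pre_digraph" where
  "generalized_petersen n k =
     \<lparr> pverts = U ` {..<n} \<union> V ` {..<n},
       parcs = gp_edges n k \<union> (gp_edges n k)\<inverse> \<rparr>"

lemma pair_graph_generalized_petersen:
  assumes "3 \<le> n" "1 \<le> k" "2 * k < n"
  shows "pair_graph (generalized_petersen n k)"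
proof -
  have neq: "(i + j) mod n \<noteq> i" if "i < n" "1 \<le> j" "j < n" for i j
    using that by (cases "i + j < n") (auto simp: mod_if)
  have sub: "gp_edges n k \<subseteq> (U ` {..<n} \<union> V ` {..<n}) \<times> (U ` {..<n} \<union> V ` {..<n})"
    using assms by (auto simp: gp_edges_def)
  have fin: "finite (gp_edges n k)"
    by (rule finite_subset[OF sub]) auto
  have irr: "(x, x) \<notin> gp_edges n k" for x
    using assms neq[of _ 1] neq[of _ k] by (auto simp: gp_edges_def)
  show ?thesis
    by unfold_locales
      (use sub fin irr in \<open>auto simp: generalized_petersen_def symmetric_def sym_Un_converse\<close>)
qed

end

theory Submission
  imports Defs
begin

text \<open>
  Let \<open>S\<close> be a zero forcing set, \<open>D\<close> a stalled set and \<open>r\<close> a bound on \<open>card (S - D)\<close>. If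
  \<open>S \<union> D\<close> is not everything, some black \<open>x\<close> forces in \<open>S \<union> D\<close>; all but one of the white vertices
  \<open>W\<close> of its closed neighbourhood, relative to \<open>D\<close>, lie in \<open>S\<close>, so that the force consumes
  \<open>card W - 1 > 0\<close> elements of \<open>S - D\<close>, and \<open>D \<union> W\<close> becomes black. Hence a family of pairs \<open>(D, r)\<close>
  with more than \<open>r\<close> vertices outside \<open>D\<close> that is closed under this step, up to automorphisms of the graph and up to
  enlarging \<open>D\<close> or \<open>r\<close>, shows for all of its members that no such \<open>S\<close> exists. For \<open>P(12,3)\<close> there
  is such a family which contains \<open>({}, 6)\<close> and consists of 18 pairs up to rotation.
\<close>

section \<open>Lower bounds for zero forcing\<close>

context pair_graph
begin

text \<open>The full vertex set is stalled, so by uniqueness of the closure it is the closure as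
  soon as it is reachable. Reachability can be handled by induction, the definite description
  cannot.\<close>

lemma zero_forcing_set_iff:
  "zero_forcing_set G S \<longleftrightarrow> S \<subseteq> pverts G \<and> (force_step G)\<^sup>*\<^sup>* S (pverts G)"
proof -
  have stalled: "stalled G (pverts G)"
    unfolding stalled_def using in_arcsD2 by (fastforce elim!: force_step.cases)
  have closure: "(force_step G)\<^sup>*\<^sup>* S (zf_closure G S)"
    unfolding zf_closure_def using theI'[OF ex1_zf_closure[of S]] by blast
  have "zf_closure G S = pverts G" if "(force_step G)\<^sup>*\<^sup>* S (pverts G)"
    unfolding zf_closure_def using that stalled ex1_zf_closure[of S]
    by (intro the1_equality) auto
  with closure show ?thesis
    unfolding zero_forcing_set_def by metis
qed

text \<open>By finiteness, an injective arc-preserving self-map is an automorphism, and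
  automorphisms carry single forces to forces.\<close>

lemma zero_forcing_set_image:
  assumes S: "zero_forcing_set G S"
    and inj: "inj_on f (pverts G)" and verts: "f ` pverts G \<subseteq> pverts G"
    and arcs: "\<And>u v. (u, v) \<in> parcs G \<Longrightarrow> (f u, f v) \<in> parcs G"
  shows "zero_forcing_set G (f ` S)"
proof -
  have verts': "f ` pverts G = pverts G"
    using verts inj by (intro endo_inj_surj) auto
  \<comment> \<open>Surjectivity on arcs ensures that \<open>f u\<close> has no neighbours besides
    the images of those of \<open>u\<close>, hence no extra white one.\<close>
  have arcs': "map_prod f f ` parcs G = parcs G"
  proof (rule endo_inj_surj)
    show "inj_on (map_prod f f) (parcs G)"
      using in_arcsD1 in_arcsD2 inj by (auto simp: inj_on_def)
  qed (use arcs in auto)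
  have preimage: "\<exists>a b. (a, b) \<in> parcs G \<and> u = f a \<and> w = f b" if "(u, w) \<in> parcs G" for u w
  proof -
    have "(u, w) \<in> map_prod f f ` parcs G"
      using that arcs' by simp
    then show ?thesis by auto
  qed
  have nbrs: "\<exists>b. (u, b) \<in> parcs G \<and> w = f b" if "(f u, w) \<in> parcs G" "u \<in> pverts G" for u w
    using preimage[OF that(1)] that(2) inj in_arcsD1 by (metis inj_onD)
  have step: "force_step G (f ` B) (f ` B') \<and> B' \<subseteq> pverts G"
    if "force_step G B B'" "B \<subseteq> pverts G" for B B'
    using that(1)
  proof cases
    case (1 u v)
    have white: "{w. (u, w) \<in> parcs G \<and> w \<notin> B} = {v}" by (fact 1)
    then have v: "(u, v) \<in> parcs G" "v \<notin> B" by blast+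
    then have u: "u \<in> pverts G" and v': "v \<in> pverts G" using in_arcsD1 in_arcsD2 by blast+
    have notin: "f w \<in> f ` B \<longleftrightarrow> w \<in> B" if "w \<in> pverts G" for w
      using inj that \<open>B \<subseteq> pverts G\<close> by (meson inj_on_image_mem_iff)
    have "{w. (f u, w) \<in> parcs G \<and> w \<notin> f ` B} = {f v}"
    proof (intro subset_antisym subsetI)
      fix w assume "w \<in> {w. (f u, w) \<in> parcs G \<and> w \<notin> f ` B}"
      then have w: "(f u, w) \<in> parcs G" "w \<notin> f ` B" by auto
      obtain b where b: "(u, b) \<in> parcs G" "w = f b"
        using nbrs[OF w(1)] u by blast
      with w(2) have "b \<in> {w. (u, w) \<in> parcs G \<and> w \<notin> B}" by auto
      then show "w \<in> {f v}" using white b(2) by simp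
    next
      fix w assume "w \<in> {f v}"
      then show "w \<in> {w. (f u, w) \<in> parcs G \<and> w \<notin> f ` B}"
        using v(2) arcs[OF v(1)] notin[OF v'] by simp
    qed
    then have "force_step G (f ` B) (insert (f v) (f ` B))"
      using 1(2) by (intro force_step.intros[of "f u"]) auto
    then show ?thesis using 1(1) v' \<open>B \<subseteq> pverts G\<close> by simp
  qed
  have steps: "(force_step G)\<^sup>*\<^sup>* (f ` B) (f ` C) \<and> C \<subseteq> pverts G"
    if "(force_step G)\<^sup>*\<^sup>* B C" "B \<subseteq> pverts G" for B C
    using that
    by (induction rule: rtranclp_induct) (use step in \<open>auto intro: rtranclp.rtrancl_into_rtrancl\<close>)
  from steps[of S "pverts G"] S show ?thesis
    unfolding zero_forcing_set_iff by (metis verts' image_mono)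
qed

text \<open>The bound \<open>r + 1 \<le> r' + card (W D x)\<close> lets the budget drop by at most
  \<open>card (W D x) - 1\<close>, stated without truncated subtraction.\<close>

lemma not_zero_forcing_set_by_invariant:
  fixes F :: "('a set \<times> nat) set" and \<Phi> :: "('a \<Rightarrow> 'a) set"
  defines "W \<equiv> \<lambda>D x. insert x {w. (x, w) \<in> parcs G} - D"
  assumes aut: "\<And>f. f \<in> \<Phi> \<Longrightarrow> inj_on f (pverts G)" "\<And>f. f \<in> \<Phi> \<Longrightarrow> f ` pverts G \<subseteq> pverts G"
      "\<And>f u v. f \<in> \<Phi> \<Longrightarrow> (u, v) \<in> parcs G \<Longrightarrow> (f u, f v) \<in> parcs G"
    and stalled: "\<And>D r. (D, r) \<in> F \<Longrightarrow> stalled G D"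
    and card: "\<And>D r. (D, r) \<in> F \<Longrightarrow> r < card (pverts G - D)"
    and step: "\<And>D r x. (D, r) \<in> F \<Longrightarrow> x \<in> pverts G \<Longrightarrow> 2 \<le> card (W D x) \<Longrightarrow> card (W D x) \<le> r + 1
      \<Longrightarrow> \<exists>D' r' f. (D', r') \<in> F \<and> f \<in> \<Phi> \<and> f ` (D \<union> W D x) \<subseteq> D' \<and> r + 1 \<le> r' + card (W D x)"
    and start: "(D, r) \<in> F" "card (S - D) \<le> r"
  shows "\<not> zero_forcing_set G S"
  using start
\<comment> \<open>\<open>S\<close> is generalized too, since passing to \<open>D'\<close> by an
  automorphism replaces \<open>S\<close> by its image.\<close>
proof (induction "card (S - D)" arbitrary: S D r rule: less_induct)
  case less
  note F = less.prems(1)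
  show ?case
  proof
    assume zf: "zero_forcing_set G S"
    have S: "S \<subseteq> pverts G" and steps: "(force_step G)\<^sup>*\<^sup>* S (pverts G)"
      using zf by (auto simp: zero_forcing_set_iff)
    have fin: "finite S" using S by (rule finite_subset) simp
    \<comment> \<open>A stalled \<open>S \<union> D\<close> would contain everything forced from
      \<open>S\<close>, so \<open>S - D\<close> would have to cover more than \<open>r\<close>
      vertices.\<close>
    have "\<not> stalled G (S \<union> D)"
    proof
      assume "stalled G (S \<union> D)"
      then have "pverts G \<subseteq> S \<union> D" by (intro force_steps_subset_stalled[OF steps]) auto
      then have "card (pverts G - D) \<le> card (S - D)" using fin by (intro card_mono) auto
      with card[OF F] less.prems(2) show False by simp
    qed
    then obtain x y where x: "x \<in> S \<union> D"
      and y: "{w. (x, w) \<in> parcs G \<and> w \<notin> S \<union> D} = {y}"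
      unfolding stalled_def by (auto elim!: force_step.cases)
    have y': "(x, y) \<in> parcs G" "y \<notin> S" "y \<notin> D" using y by auto
    let ?W = "W D x"
    have yW: "y \<in> ?W" and WS: "?W - {y} \<subseteq> S - D"
      using x y unfolding W_def by auto
    have finW: "finite ?W" using finite_subset[OF WS] fin by simp
    \<comment> \<open>Otherwise \<open>x\<close> would lie in \<open>D\<close>, as \<open>y\<close>
      is white and \<open>x\<close> is not, and could force \<open>y\<close> from \<open>D\<close>
      alone.\<close>
    have "?W \<noteq> {y}"
    proof
      assume eq: "?W = {y}"
      then have "x \<in> D" using x y'(2,3) unfolding W_def by auto
      moreover have "{w. (x, w) \<in> parcs G \<and> w \<notin> D} = {y}"
        using eq y'(1,3) \<open>x \<in> D\<close> unfolding W_def by auto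
      ultimately have "force_step G D (insert y D)" by (rule force_step.intros)
      with stalled[OF F] show False unfolding stalled_def by blast
    qed
    then have "{y} \<subset> ?W" using yW by blast
    then have "card {y} < card ?W" by (rule psubset_card_mono[OF finW])
    then have two: "2 \<le> card ?W" by simp
    have cardW: "card (?W - {y}) = card ?W - 1" using yW finW by simp
    have le: "card ?W - 1 \<le> card (S - D)"
      using card_mono[OF _ WS] fin cardW by simp
    have "x \<in> pverts G" using y'(1) in_arcsD1 by blast
    moreover have "card ?W \<le> r + 1" using le less.prems(2) by simp
    ultimately obtain D' r' f where f: "(D', r') \<in> F" "f \<in> \<Phi>"
        "f ` (D \<union> ?W) \<subseteq> D'" "r + 1 \<le> r' + card ?W"
      using step[OF F _ two] by blast
    \<comment> \<open>Since \<open>D'\<close> contains the images of \<open>D\<close> and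
      \<open>?W\<close>, it takes the \<open>card ?W - 1\<close> black vertices of \<open>?W\<close>
      out of the count; the measure drops because \<open>card ?W\<close> is at least 2.\<close>
    have "f ` S - D' \<subseteq> f ` (S - D - (?W - {y}))" using f(3) by auto
    then have "card (f ` S - D') \<le> card (f ` (S - D - (?W - {y})))"
      using fin by (intro card_mono) auto
    also have "\<dots> \<le> card (S - D - (?W - {y}))" using fin by (intro card_image_le) auto
    also have "\<dots> = card (S - D) - (card ?W - 1)"
      using WS fin finW cardW by (subst card_Diff_subset) auto
    finally have new: "card (f ` S - D') \<le> card (S - D) - (card ?W - 1)" .
    have "zero_forcing_set G (f ` S)"
      using aut[OF f(2)] zf by (intro zero_forcing_set_image) auto
    moreover have "\<not> zero_forcing_set G (f ` S)"
      using new two le f less.prems(2) by (intro less.hyps[of "f ` S" D' r']) linarith+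
    ultimately show False by blast
  qed
qed

end

section \<open>Lists of vertices of generalized Petersen graphs\<close>

definition gp_vertices :: "nat \<Rightarrow> gp_vertex list" where
  "gp_vertices n = map U [0..<n] @ map V [0..<n]"

text \<open>Adding \<open>n - 1\<close> or \<open>n - k\<close> stands for subtracting 1 or
  \<open>k\<close> modulo \<open>n\<close>, avoiding truncated subtraction.\<close>

fun gp_neighbours :: "nat \<Rightarrow> nat \<Rightarrow> gp_vertex \<Rightarrow> gp_vertex list" where
  "gp_neighbours n k (U i) = [U ((i + 1) mod n), U ((i + (n - 1)) mod n), V i]"
| "gp_neighbours n k (V i) = [V ((i + k) mod n), V ((i + (n - k)) mod n), U i]"

fun gp_shift :: "nat \<Rightarrow> nat \<Rightarrow> gp_vertex \<Rightarrow> gp_vertex" where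
  "gp_shift n s (U i) = U ((i + s) mod n)"
| "gp_shift n s (V i) = V ((i + s) mod n)"

lemma set_gp_vertices: "set (gp_vertices n) = pverts (generalized_petersen n k)"
  by (auto simp: gp_vertices_def generalized_petersen_def)

lemma add_mod_eq_iff:
  fixes i j k n :: nat
  assumes "i < n" "j < n" "k \<le> n"
  shows "j = (i + k) mod n \<longleftrightarrow> i = (j + (n - k)) mod n"
  using assms by (cases "k = n") (auto simp: mod_if)

lemma set_gp_neighbours:
  assumes "x \<in> pverts (generalized_petersen n k)" "1 \<le> k" "k < n"
  shows "set (gp_neighbours n k x) = {w. (x, w) \<in> parcs (generalized_petersen n k)}"
proof (intro subset_antisym subsetI)
  fix w assume "w \<in> set (gp_neighbours n k x)"
  then show "w \<in> {w. (x, w) \<in> parcs (generalized_petersen n k)}"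
    using assms add_mod_eq_iff[of _ n _ 1] add_mod_eq_iff[of _ n _ k]
    by (cases x) (auto simp: generalized_petersen_def gp_edges_def)
next
  fix w assume "w \<in> {w. (x, w) \<in> parcs (generalized_petersen n k)}"
  then show "w \<in> set (gp_neighbours n k x)"
    using assms add_mod_eq_iff[of _ n _ 1] add_mod_eq_iff[of _ n _ k]
    by (cases x; cases w) (auto simp: generalized_petersen_def gp_edges_def)
qed

lemma add_mod_right_cancel:
  fixes i j n s :: nat
  assumes "i < n" "j < n"
  shows "(i + s) mod n = (j + s) mod n \<longleftrightarrow> i = j"
proof
  assume "(i + s) mod n = (j + s) mod n"
  then show "i = j"
    using assms add_mod_eq_iff[of i n _ "s mod n"] add_mod_eq_iff[of j n _ "s mod n"]
    by (simp add: mod_add_right_eq)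
qed simp

section \<open>Rotations as automorphisms\<close>

lemma gp_shift_inj: "inj_on (gp_shift n s) (pverts (generalized_petersen n k))"
  by (auto simp: inj_on_def generalized_petersen_def add_mod_right_cancel)

lemma gp_shift_verts:
  "gp_shift n s ` pverts (generalized_petersen n k) \<subseteq> pverts (generalized_petersen n k)"
  by (auto simp: generalized_petersen_def)

lemma gp_shift_arcs:
  assumes "(u, v) \<in> parcs (generalized_petersen n k)"
  shows "(gp_shift n s u, gp_shift n s v) \<in> parcs (generalized_petersen n k)"
proof -
  have *: "((i + c) mod n + s) mod n = ((i + s) mod n + c) mod n" for i c
    by (simp add: mod_simps ac_simps)
  have "(gp_shift n s u, gp_shift n s v) \<in> gp_edges n k" if "(u, v) \<in> gp_edges n k" for u v
    using that *[of _ 1] by (auto simp: gp_edges_def *)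
  with assms show ?thesis by (auto simp: generalized_petersen_def)
qed

section \<open>An executable check of invariant families\<close>

definition white_nbhd :: "nat \<Rightarrow> nat \<Rightarrow> gp_vertex list \<Rightarrow> gp_vertex \<Rightarrow> gp_vertex list" where
  "white_nbhd n k D x = filter (\<lambda>y. \<not> List.member D y) (x # gp_neighbours n k x)"

text \<open>
  \<^const>\<open>find\<close> is used in place of quantifiers because \<open>code_simp\<close> stops at the first hit only
  when the recursion is guarded by a conditional.
\<close>

definition shift_into :: "nat \<Rightarrow> gp_vertex list \<Rightarrow> gp_vertex list \<Rightarrow> nat \<Rightarrow> bool" where
  "shift_into n B D s \<longleftrightarrow> find (\<lambda>y. \<not> List.member D (gp_shift n s y)) B = None"

definition absorbs ::
    "nat \<Rightarrow> (gp_vertex list \<times> nat) list \<Rightarrow> gp_vertex list \<Rightarrow> nat \<Rightarrow> bool" where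
  "absorbs n F B r \<longleftrightarrow>
     find (\<lambda>(D, q). if r \<le> q then find (shift_into n B D) [0..<n] \<noteq> None else False) F \<noteq> None"

text \<open>The three conjuncts render the hypotheses \<open>stalled\<close>, \<open>card\<close>
  and \<open>step\<close> of \<open>not_zero_forcing_set_by_invariant\<close>. The guard
  \<open>c \<le> r + 1\<close> makes the subtraction in \<open>r + 1 - c\<close> exact.\<close>

definition invariant_family :: "nat \<Rightarrow> nat \<Rightarrow> (gp_vertex list \<times> nat) list \<Rightarrow> bool" where
  "invariant_family n k F \<longleftrightarrow>
     (\<forall>(D, r) \<in> set F.
        (\<forall>x \<in> set D. length (white_nbhd n k D x) \<noteq> 1) \<and>
        r < length (filter (\<lambda>y. \<not> List.member D y) (gp_vertices n)) \<and>
        (\<forall>x \<in> set (gp_vertices n).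
           let W = white_nbhd n k D x; c = length W
           in if 2 \<le> c \<and> c \<le> r + 1 then absorbs n F (W @ D) (r + 1 - c) else True))"

lemma set_white_nbhd:
  assumes "x \<in> pverts (generalized_petersen n k)" "1 \<le> k" "k < n"
  shows "set (white_nbhd n k D x) =
    insert x {w. (x, w) \<in> parcs (generalized_petersen n k)} - set D"
  unfolding white_nbhd_def set_filter list.set set_gp_neighbours[OF assms] by auto

text \<open>The length is a cardinality because a vertex and its three listed neighbours are
  distinct: \<open>1\<close> differs from \<open>n - 1\<close> as \<open>n\<close> is at least 3,
  and \<open>k\<close> from \<open>n - k\<close> as \<open>2 * k < n\<close>.\<close>

lemma length_white_nbhd:
  assumes "x \<in> pverts (generalized_petersen n k)" "3 \<le> n" "1 \<le> k" "2 * k < n"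
  shows "length (white_nbhd n k D x) =
    card (insert x {w. (x, w) \<in> parcs (generalized_petersen n k)} - set D)"
proof -
  have neq: "(i + a) mod n \<noteq> (i + b) mod n" if "a < n" "b < n" "a \<noteq> b" for i a b
    using add_mod_right_cancel[OF that(1,2), of i] that(3) by (simp add: add.commute)
  have neq0: "i \<noteq> (i + a) mod n" if "i < n" "0 < a" "a < n" for i a
    using neq[of 0 a i] that by simp
  have "distinct (x # gp_neighbours n k x)"
    using assms neq[of 1 "n - 1"] neq[of k "n - k"]
      neq0[of _ 1] neq0[of _ "n - 1"] neq0[of _ k] neq0[of _ "n - k"]
    by (cases x) (auto simp: generalized_petersen_def)
  then have "distinct (white_nbhd n k D x)"
    unfolding white_nbhd_def by (rule distinct_filter)
  with assms show ?thesis
    using set_white_nbhd[of x n k D] by (simp flip: distinct_card)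
qed

lemma find_not_None_iff: "find P xs \<noteq> None \<longleftrightarrow> (\<exists>x \<in> set xs. P x)"
  unfolding find_None_iff by blast

lemma absorbs_iff:
  "absorbs n F B r \<longleftrightarrow>
     (\<exists>D q s. (D, q) \<in> set F \<and> r \<le> q \<and> s < n \<and> gp_shift n s ` set B \<subseteq> set D)"
proof -
  have "shift_into n B D s \<longleftrightarrow> gp_shift n s ` set B \<subseteq> set D" for D s
    by (simp add: shift_into_def find_None_iff image_subset_iff Ball_def)
  then show ?thesis
    unfolding absorbs_def find_not_None_iff
    by (simp add: split_beta Bex_def) blast
qed

lemma not_zero_forcing_set_generalized_petersen:
  assumes nk: "3 \<le> n" "1 \<le> k" "2 * k < n"
    and F: "invariant_family n k F" and start: "(D, r) \<in> set F" "card (S - set D) \<le> r"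
  shows "\<not> zero_forcing_set (generalized_petersen n k) S"
proof -
  let ?G = "generalized_petersen n k"
  interpret pair_graph ?G using nk by (rule pair_graph_generalized_petersen)
  note length = length_white_nbhd[OF _ nk]
  have fam: "\<forall>x \<in> set D. length (white_nbhd n k D x) \<noteq> 1"
      "r < length (filter (\<lambda>y. \<not> List.member D y) (gp_vertices n))"
      "\<And>x. x \<in> pverts ?G \<Longrightarrow> 2 \<le> length (white_nbhd n k D x) \<Longrightarrow>
        length (white_nbhd n k D x) \<le> r + 1 \<Longrightarrow>
        absorbs n F (white_nbhd n k D x @ D) (r + 1 - length (white_nbhd n k D x))"
    if "(D, r) \<in> set F" for D r
    using F that unfolding invariant_family_def set_gp_vertices[of n k]
    by (auto simp: Let_def split: prod.splits if_splits)
  show ?thesis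
  proof (rule not_zero_forcing_set_by_invariant[where \<Phi> = "range (gp_shift n)"
        and F = "(\<lambda>(D, r). (set D, r)) ` set F"])
    show "(set D, r) \<in> (\<lambda>(D, r). (set D, r)) ` set F" using start(1) by force
    show "card (S - set D) \<le> r" by (fact start(2))
  next
    fix f assume "f \<in> range (gp_shift n)"
    then show "inj_on f (pverts ?G)" "f ` pverts ?G \<subseteq> pverts ?G"
      using gp_shift_inj gp_shift_verts by blast+
  next
    fix f u v assume "f \<in> range (gp_shift n)" "(u, v) \<in> parcs ?G"
    then show "(f u, f v) \<in> parcs ?G" using gp_shift_arcs by blast
  next
    fix E r assume "(E, r) \<in> (\<lambda>(D, r). (set D, r)) ` set F"
    then obtain D where D: "(D, r) \<in> set F" "E = set D" by auto
    show "stalled ?G E"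
      unfolding stalled_def
    proof
      assume "\<exists>B'. force_step ?G E B'"
      then obtain u v where u: "u \<in> E" "{w. (u, w) \<in> parcs ?G \<and> w \<notin> E} = {v}"
        by (auto elim!: force_step.cases)
      then have "(u, v) \<in> parcs ?G" by blast
      then have "u \<in> pverts ?G" by (rule in_arcsD1)
      \<comment> \<open>A vertex of \<open>E\<close> drops out of its own relative neighbourhood, so
        length 1 means exactly one white neighbour.\<close>
      moreover have "insert u {w. (u, w) \<in> parcs ?G} - E = {v}" using u by auto
      ultimately have "length (white_nbhd n k D u) = 1" using length[of u D] D(2) by simp
      with fam(1)[OF D(1)] u(1) D(2) show False by blast
    qed
    have "distinct (gp_vertices n)"
      by (auto simp: gp_vertices_def distinct_map inj_on_def)
    then have "length (filter (\<lambda>y. \<not> List.member D y) (gp_vertices n)) =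
        card {y \<in> set (gp_vertices n). \<not> List.member D y}"
      by (metis distinct_card distinct_filter set_filter)
    also have "{y \<in> set (gp_vertices n). \<not> List.member D y} = pverts ?G - E"
      using D(2) by (auto simp: set_gp_vertices[of n k])
    finally show "r < card (pverts ?G - E)" using fam(2)[OF D(1)] by simp
    fix x
    let ?W = "insert x {w. (x, w) \<in> parcs ?G} - E"
    assume x: "x \<in> pverts ?G" and W: "2 \<le> card ?W" "card ?W \<le> r + 1"
    have len: "length (white_nbhd n k D x) = card ?W" using length[OF x] D(2) by simp
    have "set (white_nbhd n k D x @ D) = E \<union> ?W"
      using set_white_nbhd[OF x nk(2)] nk D(2) by auto
    with fam(3)[OF D(1) x] W obtain D' q s where "(D', q) \<in> set F" "r + 1 - card ?W \<le> q"
        "gp_shift n s ` (E \<union> ?W) \<subseteq> set D'"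
      unfolding len absorbs_iff by metis
    then show "\<exists>D' r' f. (D', r') \<in> (\<lambda>(D, r). (set D, r)) ` set F \<and> f \<in> range (gp_shift n) \<and>
        f ` (E \<union> ?W) \<subseteq> D' \<and> r + 1 \<le> r' + card ?W"
      by (intro exI[of _ "set D'"] exI[of _ q] exI[of _ "gp_shift n s"]) force
  qed
qed

section \<open>Upper bounds from explicit forcing sequences\<close>

text \<open>The first list consists of the vertices that perform the forces.\<close>

fun forcing_chain :: "nat \<Rightarrow> nat \<Rightarrow> gp_vertex list \<Rightarrow> gp_vertex list \<Rightarrow> bool" where
  "forcing_chain n k [] B \<longleftrightarrow> filter (\<lambda>y. \<not> List.member B y) (gp_vertices n) = []"
| "forcing_chain n k (u # us) B \<longleftrightarrow> List.member B u \<and>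
     (case white_nbhd n k B u of [v] \<Rightarrow> forcing_chain n k us (v # B) | _ \<Rightarrow> False)"

lemma zero_forcing_set_forcing_chain:
  assumes nk: "3 \<le> n" "1 \<le> k" "2 * k < n"
    and "set B \<subseteq> pverts (generalized_petersen n k)" "forcing_chain n k us B"
  shows "zero_forcing_set (generalized_petersen n k) (set B)"
proof -
  let ?G = "generalized_petersen n k"
  interpret pair_graph ?G using nk by (rule pair_graph_generalized_petersen)
  have "(force_step ?G)\<^sup>*\<^sup>* (set B) (pverts ?G)"
    using assms(4,5)
  proof (induction us arbitrary: B)
    case Nil
    then have "set B = pverts ?G"
      by (auto simp: filter_empty_conv set_gp_vertices[of n k])
    then show ?case by simp
  next
    case (Cons u us)
    then obtain v where v: "u \<in> set B" "white_nbhd n k B u = [v]" "forcing_chain n k us (v # B)"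
      by (auto split: list.splits)
    have u: "u \<in> pverts ?G" using v(1) Cons.prems(1) by blast
    have white: "insert u {w. (u, w) \<in> parcs ?G} - set B = {v}"
      using set_white_nbhd[OF u nk(2), of B] v(2) nk by simp
    then have step: "{w. (u, w) \<in> parcs ?G \<and> w \<notin> set B} = {v}" using v(1) by auto
    then have "(u, v) \<in> parcs ?G" by blast
    then have "v \<in> pverts ?G" by (rule in_arcsD2)
    then have "(force_step ?G)\<^sup>*\<^sup>* (set (v # B)) (pverts ?G)"
      using Cons.IH[OF _ v(3)] Cons.prems(1) by simp
    moreover have "force_step ?G (set B) (set (v # B))"
      using force_step.intros[OF v(1) step] by simp
    ultimately show ?case by (rule converse_rtranclp_into_rtranclp[rotated])
  qed
  with assms(4) show ?thesis by (simp add: zero_forcing_set_iff)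
qed

section \<open>The graph \<open>P(12,3)\<close>\<close>

text \<open>
  Found by a computer search, which followed the closures reached from the empty set and enlarged
  them, at the same budget, such that few stalled sets remain up to rotation.
\<close>

definition p12_3_family :: "(gp_vertex list \<times> nat) list" where
  "p12_3_family =
    [(map U [] @ map V [], 6),
     (map U [3, 9] @ map V [0, 3, 6], 3),
     (map U [0, 1, 11] @ map V [0], 3),
     (map U [2, 3, 4, 9] @ map V [0, 3, 6], 2),
     (map U [0, 3, 6, 9] @ map V [0, 3, 6, 9], 2),
     (map U [0, 1, 2, 11] @ map V [0, 1], 2),
     (map U [2, 3, 4, 5, 9] @ map V [0, 3, 4, 6], 1),
     (map U [1, 2, 3, 4, 9] @ map V [0, 2, 3, 6], 1),
     (map U [0, 2, 3, 4, 6, 9] @ map V [0, 3, 6, 9], 1),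
     (map U [0, 1, 5, 11] @ map V [0, 2, 5, 7, 8], 1),
     (map U [3, 7, 8, 9] @ map V [0, 1, 3, 6, 8], 1),
     (map U [0, 1, 2, 3, 11] @ map V [0, 1, 2, 6, 8], 1),
     (map U [4, 5, 6, 9, 10, 11] @ map V [0, 1, 2, 3, 5, 7, 8, 10], 0),
     (map U [0, 1, 2, 3, 5, 6, 7, 9, 11] @ map V [0, 1, 2, 4, 6, 8, 10], 0),
     (map U [1, 3, 5, 7, 9, 11] @ map V [0, 1, 2, 3, 4, 5, 6, 8, 10], 0),
     (map U [0, 3, 5, 6, 7, 8, 9, 10] @ map V [0, 1, 2, 3, 6, 7, 8, 9], 0),
     (map U [3, 4, 5, 6, 10, 11] @ map V [0, 1, 2, 4, 5, 7, 8, 9], 0),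
     (map U [1, 3, 4, 5, 7, 9, 10, 11] @ map V [0, 1, 2, 4, 6, 7, 8, 10], 0)]"

text \<open>A finite evaluation. For pairs of budget 0 the guard
  \<open>2 \<le> c \<and> c \<le> r + 1\<close> fails, so the recursion ends there: only stalledness
  and a remaining white vertex are tested.\<close>

lemma invariant_family_p12_3: "invariant_family 12 3 p12_3_family"
  by code_simp

theorem proposition3:
  shows "(\<forall>S. S \<subseteq> pverts (generalized_petersen 12 3) \<and> card S = 6 \<longrightarrow>
            \<not> zero_forcing_set (generalized_petersen 12 3) S)
         \<and> zero_forcing_number (generalized_petersen 12 3) = 7"
proof -
  let ?G = "generalized_petersen 12 3"
  \<comment> \<open>Treating all sizes up to 6 at once also gives the minimality of 7.\<close>
  have lower: "\<not> zero_forcing_set ?G S" if "card S \<le> 6" for S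
  proof (rule not_zero_forcing_set_generalized_petersen[OF _ _ _ invariant_family_p12_3])
    show "([], 6) \<in> set p12_3_family" by (simp add: p12_3_family_def)
  qed (use that in simp_all)
  \<comment> \<open>Seven consecutive outer vertices. The inner five, \<open>U 1\<close> to
    \<open>U 5\<close>, first force \<open>V 1\<close> to \<open>V 5\<close>; in all, 17 forces
    blacken the other 24 - 7 vertices.\<close>
  let ?B = "map U [0..<7]"
  have "forcing_chain 12 3
      [U 1, U 2, U 3, U 4, U 5, V 1, V 2, V 4, V 5, V 7, U 6, U 7, U 8, V 3, U 0, U 11, U 9] ?B"
    by code_simp
  then have "zero_forcing_set ?G (set ?B)"
    by (rule zero_forcing_set_forcing_chain[rotated 4]) (auto simp: generalized_petersen_def)
  moreover have "card (set ?B) = 7"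
    by (simp add: card_image inj_on_def)
  ultimately have upper: "\<exists>S. zero_forcing_set ?G S \<and> card S = 7" by blast
  have "zero_forcing_number ?G = 7"
    unfolding zero_forcing_number_def
  proof (rule Least_equality)
    show "\<exists>S. zero_forcing_set ?G S \<and> card S = 7" by (fact upper)
  next
    fix m assume "\<exists>S. zero_forcing_set ?G S \<and> card S = m"
    then have "\<not> m \<le> 6" using lower by blast
    then show "7 \<le> m" by simp
  qed
  with lower show ?thesis by simp
qed

end
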